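(* Let $S$ be an $F$-inverse monoid. Define the relation $\tilde{\mu}$ on $S$ by setting, for all $a,b\in S$, $a\mathrel{\tilde{\mu}}b$ if and only if $a\mathrel{\mu}b$ and $$(xay)^{\mathfrak m}\,e\,\big((xay)^{\mathfrak m}\big)^{-1}=(xby)^{\mathfrak m}\,e\,\big((xby)^{\mathfrak m}\big)^{-1}\quad\text{for all }x,y\in S,\ e\in E(S).$$ Then $\tilde{\mu}$ is the greatest idempotent-separating $F$-congruence on $S$.
   Context: For an inverse semigroup $S$, $E(S)$ is its set of idempotents, $\leq$ is the natural partial order ($s\leq t$ iff $s=et$ for some $e\in E(S)$), and $\sigma$ is the minimum group congruence ($s\mathrel{\sigma}t$ iff $es=et$ for some $e\in E(S)$). $S$ is $F$-inverse if every $\sigma$-class has a maximum element with respect to $\leq$; such an $S$ is automatically a monoid. For $a\in S$, $a^{\mathfrak m}$ denotes the maximum element of the $\sigma$-class of $a$. An $F$-congruence on an $F$-inverse monoid $S$ is a (two-sided, multiplicative) congruence $\rho$ such that $a\mathrel{\rho}b$ implies $a^{\mathfrak m}\mathrel{\rho}b^{\mathfrak m}$ for all $a,b\in S$. A congruence is idempotent-separating if distinct idempotents are never related. $\mu$ is the greatest idempotent-separating congruence on $S$, given by: $a\mathrel{\mu}b$ iff $aea^{-1}=beb^{-1}$ for all $e\in E(S)$. "Greatest" is with respect to inclusion of relations. *)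

theory Defs
  imports "HOL-Algebra.Group"
begin

text \<open>
  A semigroup lives on \<open>carrier S\<close>. Binary relations on it are sets of pairs contained in
  \<open>carrier S \<times> carrier S\<close>. The function \<open>m_inv\<close> of HOL-Algebra inverts units only; the
  inverse of an inverse semigroup is \<open>sg_inv\<close>.
\<close>

locale inverse_monoid = monoid S for S (structure) +
  assumes ex1_inverse:
    "a \<in> carrier S \<Longrightarrow> \<exists>!b. b \<in> carrier S \<and> a \<otimes> b \<otimes> a = a \<and> b \<otimes> a \<otimes> b = b"

definition sg_inv :: "('a, 'b) monoid_scheme \<Rightarrow> 'a \<Rightarrow> 'a" where
  "sg_inv S a = (THE b. b \<in> carrier S \<and> a \<otimes>\<^bsub>S\<^esub> b \<otimes>\<^bsub>S\<^esub> a = a \<and> b \<otimes>\<^bsub>S\<^esub> a \<otimes>\<^bsub>S\<^esub> b = b)"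

definition idems :: "('a, 'b) monoid_scheme \<Rightarrow> 'a set" where
  "idems S = {e \<in> carrier S. e \<otimes>\<^bsub>S\<^esub> e = e}"

definition nat_le :: "('a, 'b) monoid_scheme \<Rightarrow> 'a \<Rightarrow> 'a \<Rightarrow> bool" where
  "nat_le S s t \<longleftrightarrow> s \<in> carrier S \<and> t \<in> carrier S \<and> (\<exists>e \<in> idems S. s = e \<otimes>\<^bsub>S\<^esub> t)"

definition sigma_rel :: "('a, 'b) monoid_scheme \<Rightarrow> ('a \<times> 'a) set" where
  "sigma_rel S = {(s, t). s \<in> carrier S \<and> t \<in> carrier S \<and>
     (\<exists>e \<in> idems S. e \<otimes>\<^bsub>S\<^esub> s = e \<otimes>\<^bsub>S\<^esub> t)}"

definition is_max :: "('a, 'b) monoid_scheme \<Rightarrow> 'a set \<Rightarrow> 'a \<Rightarrow> bool" where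
  "is_max S C m \<longleftrightarrow> m \<in> C \<and> (\<forall>b \<in> C. nat_le S b m)"

locale F_inverse_monoid = inverse_monoid S for S (structure) +
  assumes ex_max: "C \<in> carrier S // sigma_rel S \<Longrightarrow> \<exists>m. is_max S C m"

definition max_elt :: "('a, 'b) monoid_scheme \<Rightarrow> 'a \<Rightarrow> 'a" where
  "max_elt S a = (THE m. is_max S (sigma_rel S `` {a}) m)"

definition congruence :: "('a, 'b) monoid_scheme \<Rightarrow> ('a \<times> 'a) set \<Rightarrow> bool" where
  "congruence S \<rho> \<longleftrightarrow> equiv (carrier S) \<rho> \<and>
     (\<forall>(a, b) \<in> \<rho>. \<forall>(c, d) \<in> \<rho>. (a \<otimes>\<^bsub>S\<^esub> c, b \<otimes>\<^bsub>S\<^esub> d) \<in> \<rho>)"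

definition F_congruence :: "('a, 'b) monoid_scheme \<Rightarrow> ('a \<times> 'a) set \<Rightarrow> bool" where
  "F_congruence S \<rho> \<longleftrightarrow> congruence S \<rho> \<and> (\<forall>(a, b) \<in> \<rho>. (max_elt S a, max_elt S b) \<in> \<rho>)"

definition idempotent_separating :: "('a, 'b) monoid_scheme \<Rightarrow> ('a \<times> 'a) set \<Rightarrow> bool" where
  "idempotent_separating S \<rho> \<longleftrightarrow> (\<forall>e \<in> idems S. \<forall>f \<in> idems S. (e, f) \<in> \<rho> \<longrightarrow> e = f)"

text \<open>See \<open>mu_rel_greatest\<close> below for the characterization as the greatest
  idempotent-separating congruence.\<close>

definition mu_rel :: "('a, 'b) monoid_scheme \<Rightarrow> ('a \<times> 'a) set" where
  "mu_rel S = {(a, b). a \<in> carrier S \<and> b \<in> carrier S \<and>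
     (\<forall>e \<in> idems S. a \<otimes>\<^bsub>S\<^esub> e \<otimes>\<^bsub>S\<^esub> sg_inv S a = b \<otimes>\<^bsub>S\<^esub> e \<otimes>\<^bsub>S\<^esub> sg_inv S b)}"

definition mu_tilde :: "('a, 'b) monoid_scheme \<Rightarrow> ('a \<times> 'a) set" where
  "mu_tilde S = {(a, b). (a, b) \<in> mu_rel S \<and>
     (\<forall>x \<in> carrier S. \<forall>y \<in> carrier S. \<forall>e \<in> idems S.
        max_elt S (x \<otimes>\<^bsub>S\<^esub> a \<otimes>\<^bsub>S\<^esub> y) \<otimes>\<^bsub>S\<^esub> e \<otimes>\<^bsub>S\<^esub> sg_inv S (max_elt S (x \<otimes>\<^bsub>S\<^esub> a \<otimes>\<^bsub>S\<^esub> y))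
      = max_elt S (x \<otimes>\<^bsub>S\<^esub> b \<otimes>\<^bsub>S\<^esub> y) \<otimes>\<^bsub>S\<^esub> e \<otimes>\<^bsub>S\<^esub> sg_inv S (max_elt S (x \<otimes>\<^bsub>S\<^esub> b \<otimes>\<^bsub>S\<^esub> y)))}"


section \<open>The definite descriptions and \<open>mu_rel\<close> are as intended\<close>

context inverse_monoid
begin

lemma sg_inv:
  assumes "a \<in> carrier S"
  shows sg_inv_closed [simp]: "sg_inv S a \<in> carrier S"
    and sg_inv_1: "a \<otimes> sg_inv S a \<otimes> a = a"
    and sg_inv_2: "sg_inv S a \<otimes> a \<otimes> sg_inv S a = sg_inv S a"
  using theI'[OF ex1_inverse[OF assms]] unfolding sg_inv_def by auto

lemma sg_inv_eqI:
  assumes "a \<in> carrier S" "b \<in> carrier S" "a \<otimes> b \<otimes> a = a" "b \<otimes> a \<otimes> b = b"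
  shows "sg_inv S a = b"
  using ex1_inverse[OF assms(1)] sg_inv[OF assms(1)] assms by blast

lemma Idem_carrier: "e \<in> idems S \<Longrightarrow> e \<in> carrier S"
  and Idem_sq: "e \<in> idems S \<Longrightarrow> e \<otimes> e = e"
  by (auto simp: idems_def)

lemma one_Idem: "\<one> \<in> idems S"
  by (simp add: idems_def)

lemma sg_inv_Idem: "e \<in> idems S \<Longrightarrow> sg_inv S e = e"
  by (rule sg_inv_eqI) (auto simp: idems_def)

lemma Idem_mult_Idem:
  assumes e: "e \<in> idems S" and f: "f \<in> idems S"
  shows "e \<otimes> f \<in> idems S"
proof -
  note [simp] = e[THEN Idem_carrier] f[THEN Idem_carrier] e[THEN Idem_sq] f[THEN Idem_sq]
  define x where "x = sg_inv S (e \<otimes> f)"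
  have xc [simp]: "x \<in> carrier S" by (simp add: x_def)
  have x1: "e \<otimes> f \<otimes> x \<otimes> (e \<otimes> f) = e \<otimes> f" and x2: "x \<otimes> (e \<otimes> f) \<otimes> x = x"
    using sg_inv[of "e \<otimes> f"] by (simp_all add: x_def)
  have ee: "e \<otimes> (e \<otimes> z) = e \<otimes> z" and ff: "f \<otimes> (f \<otimes> z) = f \<otimes> z" if "z \<in> carrier S" for z
    using that by (simp_all flip: m_assoc)
  have x2': "x \<otimes> (e \<otimes> (f \<otimes> (x \<otimes> z))) = x \<otimes> z" if "z \<in> carrier S" for z
    using that arg_cong[OF x2, of "\<lambda>u. u \<otimes> z"] by (simp add: m_assoc)
  have "x = f \<otimes> x \<otimes> e"
    unfolding x_def
  proof (rule sg_inv_eqI, unfold x_def[symmetric])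
    show "e \<otimes> f \<otimes> (f \<otimes> x \<otimes> e) \<otimes> (e \<otimes> f) = e \<otimes> f"
      using x1 by (simp add: m_assoc ee ff)
    show "f \<otimes> x \<otimes> e \<otimes> (e \<otimes> f) \<otimes> (f \<otimes> x \<otimes> e) = f \<otimes> x \<otimes> e"
      by (simp add: m_assoc ee ff x2')
  qed simp_all
  moreover have "(f \<otimes> x \<otimes> e) \<otimes> (f \<otimes> x \<otimes> e) = f \<otimes> x \<otimes> e"
    by (simp add: m_assoc x2')
  ultimately have xI: "x \<in> idems S"
    unfolding idems_def using xc by auto
  have "sg_inv S x = e \<otimes> f"
    using x1 x2 by (intro sg_inv_eqI) simp_all
  with sg_inv_Idem[OF xI] xI show ?thesis by simp
qed

lemma Idem_commute:
  assumes e: "e \<in> idems S" and f: "f \<in> idems S"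
  shows "e \<otimes> f = f \<otimes> e"
proof -
  note [simp] = e[THEN Idem_carrier] f[THEN Idem_carrier] e[THEN Idem_sq] f[THEN Idem_sq]
  have ee: "e \<otimes> (e \<otimes> z) = e \<otimes> z" and ff: "f \<otimes> (f \<otimes> z) = f \<otimes> z" if "z \<in> carrier S" for z
    using that by (simp_all flip: m_assoc)
  have "sg_inv S (e \<otimes> f) = f \<otimes> e"
    using Idem_mult_Idem[OF e f, THEN Idem_sq] Idem_mult_Idem[OF f e, THEN Idem_sq]
    by (intro sg_inv_eqI) (simp_all add: m_assoc ee ff)
  then show ?thesis
    using sg_inv_Idem[OF Idem_mult_Idem[OF e f]] by simp
qed

lemma mult_inv_Idem: "a \<in> carrier S \<Longrightarrow> a \<otimes> sg_inv S a \<in> idems S"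
  and inv_mult_Idem: "a \<in> carrier S \<Longrightarrow> sg_inv S a \<otimes> a \<in> idems S"
  using sg_inv[of a] by (auto simp: idems_def simp flip: m_assoc)

lemma conj_Idem:
  assumes a: "a \<in> carrier S" and e: "e \<in> idems S"
  shows "a \<otimes> e \<otimes> sg_inv S a \<in> idems S"
proof -
  note [simp] = a e[THEN Idem_carrier]
  let ?a = "sg_inv S a"
  have "(a \<otimes> e \<otimes> ?a) \<otimes> (a \<otimes> e \<otimes> ?a) = a \<otimes> (e \<otimes> (?a \<otimes> a)) \<otimes> e \<otimes> ?a"
    by (simp add: m_assoc)
  also have "\<dots> = a \<otimes> ((?a \<otimes> a) \<otimes> e) \<otimes> e \<otimes> ?a"
    using Idem_commute[OF e inv_mult_Idem[OF a]] by simp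
  also have "\<dots> = (a \<otimes> ?a \<otimes> a) \<otimes> (e \<otimes> e) \<otimes> ?a"
    by (simp add: m_assoc)
  also have "\<dots> = a \<otimes> e \<otimes> ?a"
    by (simp add: sg_inv_1 Idem_sq[OF e])
  finally show ?thesis by (simp add: idems_def)
qed

lemma sg_inv_mult:
  assumes a: "a \<in> carrier S" and b: "b \<in> carrier S"
  shows "sg_inv S (a \<otimes> b) = sg_inv S b \<otimes> sg_inv S a"
proof -
  note [simp] = a b
  let ?a = "sg_inv S a" and ?b = "sg_inv S b"
  have c: "(?a \<otimes> a) \<otimes> (b \<otimes> ?b) = (b \<otimes> ?b) \<otimes> (?a \<otimes> a)"
    by (rule Idem_commute) (simp_all add: mult_inv_Idem inv_mult_Idem)
  show ?thesis
  proof (rule sg_inv_eqI)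
    have "a \<otimes> b \<otimes> (?b \<otimes> ?a) \<otimes> (a \<otimes> b) = a \<otimes> ((b \<otimes> ?b) \<otimes> (?a \<otimes> a)) \<otimes> b"
      by (simp add: m_assoc)
    also have "\<dots> = (a \<otimes> ?a \<otimes> a) \<otimes> (b \<otimes> ?b \<otimes> b)"
      unfolding c[symmetric] by (simp add: m_assoc)
    finally show "a \<otimes> b \<otimes> (?b \<otimes> ?a) \<otimes> (a \<otimes> b) = a \<otimes> b"
      by (simp add: sg_inv_1)
    have "?b \<otimes> ?a \<otimes> (a \<otimes> b) \<otimes> (?b \<otimes> ?a) = ?b \<otimes> ((?a \<otimes> a) \<otimes> (b \<otimes> ?b)) \<otimes> ?a"
      by (simp add: m_assoc)
    also have "\<dots> = (?b \<otimes> b \<otimes> ?b) \<otimes> (?a \<otimes> a \<otimes> ?a)"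
      unfolding c by (simp add: m_assoc)
    finally show "?b \<otimes> ?a \<otimes> (a \<otimes> b) \<otimes> (?b \<otimes> ?a) = ?b \<otimes> ?a"
      by (simp add: sg_inv_2)
  qed simp_all
qed

lemma nat_le_antisym:
  assumes "nat_le S s t" "nat_le S t s"
  shows "s = t"
proof -
  from assms obtain e f where e: "e \<in> idems S" "s = e \<otimes> t" and f: "f \<in> idems S" "t = f \<otimes> s"
    and [simp]: "s \<in> carrier S" "t \<in> carrier S"
    by (auto simp: nat_le_def)
  note [simp] = e(1)[THEN Idem_carrier] f(1)[THEN Idem_carrier]
  have es: "e \<otimes> s = s"
    unfolding e(2) by (simp add: Idem_sq[OF e(1)] flip: m_assoc)
  have "s = e \<otimes> (f \<otimes> s)" using e(2) f(2) by simp
  also have "\<dots> = (e \<otimes> f) \<otimes> s" by (simp add: m_assoc)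
  also have "\<dots> = f \<otimes> (e \<otimes> s)"
    unfolding Idem_commute[OF e(1) f(1)] by (simp add: m_assoc)
  finally show ?thesis using es f(2) by simp
qed

lemma equiv_sigma_rel: "equiv (carrier S) (sigma_rel S)"
proof (rule equivI)
  show "sigma_rel S \<subseteq> carrier S \<times> carrier S" by (auto simp: sigma_rel_def)
  show "refl_on (carrier S) (sigma_rel S)"
    using one_Idem by (auto simp: refl_on_def sigma_rel_def)
  show "sym (sigma_rel S)" by (auto simp: sym_def sigma_rel_def) metis
  show "trans (sigma_rel S)"
  proof (rule transI)
    fix s t u assume "(s, t) \<in> sigma_rel S" "(t, u) \<in> sigma_rel S"
    then obtain e f where e: "e \<in> idems S" "e \<otimes> s = e \<otimes> t" and f: "f \<in> idems S" "f \<otimes> t = f \<otimes> u"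
      and [simp]: "s \<in> carrier S" "t \<in> carrier S" "u \<in> carrier S"
      by (auto simp: sigma_rel_def)
    note [simp] = e(1)[THEN Idem_carrier] f(1)[THEN Idem_carrier]
    have c: "f \<otimes> e = e \<otimes> f" by (rule Idem_commute[OF f(1) e(1)])
    have "(f \<otimes> e) \<otimes> s = (f \<otimes> e) \<otimes> t" by (simp add: m_assoc e)
    also have "\<dots> = e \<otimes> (f \<otimes> t)" unfolding c by (simp add: m_assoc)
    also have "\<dots> = (f \<otimes> e) \<otimes> u" unfolding c by (simp add: m_assoc f)
    finally show "(s, u) \<in> sigma_rel S"
      using Idem_mult_Idem[OF f(1) e(1)] by (auto simp: sigma_rel_def)
  qed
qed

lemma congruence_mu_rel: "congruence S (mu_rel S)"
proof -
  have "(a \<otimes> c, b \<otimes> d) \<in> mu_rel S" if ab: "(a, b) \<in> mu_rel S" and cd: "(c, d) \<in> mu_rel S" for a b c d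
  proof -
    have [simp]: "a \<in> carrier S" "b \<in> carrier S" "c \<in> carrier S" "d \<in> carrier S"
      using ab cd by (auto simp: mu_rel_def)
    have "a \<otimes> c \<otimes> e \<otimes> sg_inv S (a \<otimes> c) = b \<otimes> d \<otimes> e \<otimes> sg_inv S (b \<otimes> d)" if e: "e \<in> idems S" for e
    proof -
      note [simp] = e[THEN Idem_carrier]
      have "a \<otimes> c \<otimes> e \<otimes> sg_inv S (a \<otimes> c) = a \<otimes> (c \<otimes> e \<otimes> sg_inv S c) \<otimes> sg_inv S a"
        by (simp add: sg_inv_mult m_assoc)
      also have "\<dots> = b \<otimes> (c \<otimes> e \<otimes> sg_inv S c) \<otimes> sg_inv S b"
        using ab conj_Idem[OF _ e, of c] by (auto simp: mu_rel_def)
      also have "\<dots> = b \<otimes> (d \<otimes> e \<otimes> sg_inv S d) \<otimes> sg_inv S b"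
        using cd e by (auto simp: mu_rel_def)
      also have "\<dots> = b \<otimes> d \<otimes> e \<otimes> sg_inv S (b \<otimes> d)"
        by (simp add: sg_inv_mult m_assoc)
      finally show ?thesis .
    qed
    then show ?thesis by (simp add: mu_rel_def)
  qed
  moreover have "equiv (carrier S) (mu_rel S)"
    by (rule equivI) (auto simp: mu_rel_def refl_on_def sym_def trans_def)
  ultimately show ?thesis unfolding congruence_def by blast
qed

lemma idempotent_separating_mu_rel: "idempotent_separating S (mu_rel S)"
  unfolding idempotent_separating_def
proof (intro ballI impI)
  fix e f assume e: "e \<in> idems S" and f: "f \<in> idems S" and ef: "(e, f) \<in> mu_rel S"
  note [simp] = e[THEN Idem_carrier] f[THEN Idem_carrier] e[THEN Idem_sq] f[THEN Idem_sq]
  have ff: "f \<otimes> (f \<otimes> z) = f \<otimes> z" and ee: "e \<otimes> (e \<otimes> z) = e \<otimes> z" if "z \<in> carrier S" for z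
    using that by (simp_all flip: m_assoc)
  have 1: "e \<otimes> e \<otimes> e = f \<otimes> e \<otimes> f" and 2: "e \<otimes> f \<otimes> e = f \<otimes> f \<otimes> f"
    using ef e f by (auto simp: mu_rel_def sg_inv_Idem)
  have c: "e \<otimes> f = f \<otimes> e" by (rule Idem_commute[OF e f])
  have "e = f \<otimes> e" using 1 c by (simp add: m_assoc ff)
  moreover have "f = e \<otimes> f" using 2 c by (simp add: m_assoc ee)
  ultimately show "e = f" using c by simp
qed

lemma mu_rel_greatest:
  assumes \<rho>: "congruence S \<rho>" and sep: "idempotent_separating S \<rho>"
  shows "\<rho> \<subseteq> mu_rel S"
proof (rule subrelI)
  fix a b assume ab: "(a, b) \<in> \<rho>"
  have eq: "equiv (carrier S) \<rho>"
    and mult: "\<And>a b c d. (a, b) \<in> \<rho> \<Longrightarrow> (c, d) \<in> \<rho> \<Longrightarrow> (a \<otimes> c, b \<otimes> d) \<in> \<rho>"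
    using \<rho> unfolding congruence_def by blast+
  have rfl: "(z, z) \<in> \<rho>" if "z \<in> carrier S" for z
    using eq that by (auto simp: equiv_def refl_on_def)
  have sy: "(z, y) \<in> \<rho>" if "(y, z) \<in> \<rho>" for y z
    using eq that by (auto simp: equiv_def sym_def)
  have tr: "(x, z) \<in> \<rho>" if "(x, y) \<in> \<rho>" "(y, z) \<in> \<rho>" for x y z
    using eq that unfolding equiv_def trans_def by blast
  have [simp]: "a \<in> carrier S" "b \<in> carrier S"
    using ab eq by (auto simp: equiv_def)
  define x where "x = sg_inv S a"
  define y where "y = sg_inv S b"
  have [simp]: "x \<in> carrier S" "y \<in> carrier S" by (simp_all add: x_def y_def)
  have x: "a \<otimes> x \<otimes> a = a" "x \<otimes> a \<otimes> x = x" "a \<otimes> x \<in> idems S" "x \<otimes> a \<in> idems S"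
    by (simp_all add: x_def sg_inv_1 sg_inv_2 mult_inv_Idem inv_mult_Idem)
  have y: "b \<otimes> y \<otimes> b = b" "y \<otimes> b \<otimes> y = y" "b \<otimes> y \<in> idems S" "y \<otimes> b \<in> idems S"
    by (simp_all add: y_def sg_inv_1 sg_inv_2 mult_inv_Idem inv_mult_Idem)
  have "(a, b \<otimes> y \<otimes> b) \<in> \<rho>" using ab y by simp
  moreover have "(b \<otimes> y \<otimes> b, b \<otimes> y \<otimes> a) \<in> \<rho>" by (intro mult rfl sy[OF ab]) simp_all
  ultimately have "(a, b \<otimes> y \<otimes> a) \<in> \<rho>" by (rule tr)
  then have "(x \<otimes> a \<otimes> x, x \<otimes> (b \<otimes> y \<otimes> a) \<otimes> x) \<in> \<rho>" by (intro mult rfl) simp_all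
  moreover have "x \<otimes> (b \<otimes> y \<otimes> a) \<otimes> x = x \<otimes> ((b \<otimes> y) \<otimes> (a \<otimes> x))" by (simp add: m_assoc)
  moreover have "\<dots> = (x \<otimes> a \<otimes> x) \<otimes> (b \<otimes> y)"
    unfolding Idem_commute[OF y(3) x(3)] by (simp add: m_assoc)
  ultimately have 1: "(x, x \<otimes> (b \<otimes> y)) \<in> \<rho>" using x by simp
  have "(b, a \<otimes> x \<otimes> a) \<in> \<rho>" using sy[OF ab] x by simp
  moreover have "(a \<otimes> x \<otimes> a, b \<otimes> x \<otimes> a) \<in> \<rho>" by (intro mult rfl ab) simp_all
  ultimately have "(b, b \<otimes> x \<otimes> a) \<in> \<rho>" by (rule tr)
  then have "(y \<otimes> b \<otimes> y, y \<otimes> (b \<otimes> x \<otimes> a) \<otimes> y) \<in> \<rho>" by (intro mult rfl) simp_all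
  moreover have "y \<otimes> (b \<otimes> x \<otimes> a) \<otimes> y = ((y \<otimes> b) \<otimes> (x \<otimes> a)) \<otimes> y" by (simp add: m_assoc)
  moreover have "\<dots> = x \<otimes> a \<otimes> (y \<otimes> b \<otimes> y)"
    unfolding Idem_commute[OF y(4) x(4)] by (simp add: m_assoc)
  ultimately have 2: "(y, x \<otimes> (a \<otimes> y)) \<in> \<rho>" using y by (simp add: m_assoc)
  have "(x \<otimes> (a \<otimes> y), x \<otimes> (b \<otimes> y)) \<in> \<rho>" by (intro mult rfl ab) simp_all
  with 1 2 have xy: "(x, y) \<in> \<rho>" by (meson sy tr)
  have "a \<otimes> e \<otimes> x = b \<otimes> e \<otimes> y" if e: "e \<in> idems S" for e
  proof -
    have "(a \<otimes> e \<otimes> x, b \<otimes> e \<otimes> y) \<in> \<rho>"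
      using e[THEN Idem_carrier] by (intro mult rfl ab xy)
    moreover have "a \<otimes> e \<otimes> x \<in> idems S" "b \<otimes> e \<otimes> y \<in> idems S"
      using e by (simp_all add: x_def y_def conj_Idem)
    ultimately show ?thesis using sep by (auto simp: idempotent_separating_def)
  qed
  then show "(a, b) \<in> mu_rel S" by (simp add: mu_rel_def x_def y_def)
qed

end

lemma (in F_inverse_monoid) is_max_max_elt:
  assumes "a \<in> carrier S"
  shows "is_max S (sigma_rel S `` {a}) (max_elt S a)"
proof -
  obtain m where m: "is_max S (sigma_rel S `` {a}) m"
    using ex_max[OF quotientI[OF assms]] by blast
  moreover have "m' = m" if "is_max S (sigma_rel S `` {a}) m'" for m'
    using that m by (auto simp: is_max_def intro: nat_le_antisym)
  ultimately show ?thesis unfolding max_elt_def by (rule theI)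
qed

end

theory Submission
  imports Defs
begin

text \<open>
  Write \<open>m a\<close> for \<open>max_elt S a\<close>. The defining condition of \<open>mu_tilde S\<close> only says that
  \<open>a \<mu> b\<close> and \<open>m (x a y) \<mu> m (x b y)\<close> for all \<open>x\<close> and \<open>y\<close> (\<open>mu_tilde_iff\<close>), so \<open>mu_tilde S\<close>
  lies inside \<open>\<mu>\<close>. Hence it is idempotent-separating. The contexts \<open>x _ y\<close> make it a
  congruence: \<open>m (x a c y)\<close> passes to \<open>m (x b c y)\<close> in the context \<open>x _ c y\<close>, and then to
  \<open>m (x b d y)\<close> in the context \<open>x b _ y\<close>.

  It respects \<open>m\<close> because \<open>m\<close> depends on the \<open>\<sigma>\<close>-class alone, and \<open>\<sigma>\<close> is a congruence
  with \<open>m a \<sigma> a\<close>. Thus \<open>m (x (m a) y) = m (x a y)\<close> (\<open>max_elt_context\<close>), so the conditions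
  required of the pair \<open>m a\<close>, \<open>m b\<close> are among those already known for \<open>a\<close>, \<open>b\<close>.

  Conversely, an idempotent-separating \<open>F\<close>-congruence is contained in \<open>\<mu>\<close>, the greatest
  idempotent-separating congruence. It is closed under the passage from \<open>a\<close>, \<open>b\<close> to
  \<open>m (x a y)\<close>, \<open>m (x b y)\<close>, so these pairs also lie in \<open>\<mu>\<close>.
\<close>

context inverse_monoid
begin

text \<open>
  Multiplying on the left needs a new witness: if \<open>e\<close> equalizes \<open>s\<close> and \<open>t\<close>, then its conjugate
  \<open>x e x\<inverse>\<close> equalizes \<open>x s\<close> and \<open>x t\<close>, because \<open>(x e x\<inverse>) x = x e\<close>.
\<close>

lemma sigma_rel_context:
  assumes st: "(s, t) \<in> sigma_rel S"
    and [simp]: "x \<in> carrier S" "y \<in> carrier S"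
  shows "(x \<otimes> s \<otimes> y, x \<otimes> t \<otimes> y) \<in> sigma_rel S"
proof -
  from st obtain e where e: "e \<in> idems S" and eq: "e \<otimes> s = e \<otimes> t"
    and [simp]: "s \<in> carrier S" "t \<in> carrier S"
    by (auto simp: sigma_rel_def)
  note [simp] = e[THEN Idem_carrier]
  let ?f = "x \<otimes> e \<otimes> sg_inv S x"
  have "?f \<otimes> x = x \<otimes> (e \<otimes> (sg_inv S x \<otimes> x))"
    by (simp add: m_assoc)
  also have "\<dots> = x \<otimes> sg_inv S x \<otimes> x \<otimes> e"
    by (subst Idem_commute[OF e inv_mult_Idem]) (simp_all add: m_assoc)
  finally have fx: "?f \<otimes> x = x \<otimes> e"
    by (simp add: sg_inv_1)
  have absorb: "?f \<otimes> (x \<otimes> u \<otimes> y) = x \<otimes> (e \<otimes> u) \<otimes> y" if [simp]: "u \<in> carrier S" for u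
  proof -
    have "?f \<otimes> (x \<otimes> u \<otimes> y) = (?f \<otimes> x) \<otimes> u \<otimes> y" by (simp add: m_assoc)
    then show ?thesis unfolding fx by (simp add: m_assoc)
  qed
  have "?f \<otimes> (x \<otimes> s \<otimes> y) = ?f \<otimes> (x \<otimes> t \<otimes> y)"
    by (simp only: absorb \<open>s \<in> carrier S\<close> \<open>t \<in> carrier S\<close> eq)
  moreover have "?f \<in> idems S" by (simp add: conj_Idem e)
  ultimately show ?thesis by (auto simp: sigma_rel_def)
qed

lemma max_elt_eq:
  assumes "(a, b) \<in> sigma_rel S"
  shows "max_elt S a = max_elt S b"
  unfolding max_elt_def using equiv_class_eq[OF equiv_sigma_rel assms] by simp

lemma mu_tilde_subset: "mu_tilde S \<subseteq> mu_rel S"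
  by (auto simp: mu_tilde_def)

lemma idempotent_separating_mu_tilde: "idempotent_separating S (mu_tilde S)"
  using idempotent_separating_mu_rel mu_tilde_subset
  unfolding idempotent_separating_def by blast

end

context F_inverse_monoid
begin

lemma max_elt_sigma: "a \<in> carrier S \<Longrightarrow> (a, max_elt S a) \<in> sigma_rel S"
  using is_max_max_elt by (auto simp: is_max_def)

lemma max_elt_closed [simp]: "a \<in> carrier S \<Longrightarrow> max_elt S a \<in> carrier S"
  using max_elt_sigma by (auto simp: sigma_rel_def)

lemma max_elt_context:
  assumes "a \<in> carrier S" "x \<in> carrier S" "y \<in> carrier S"
  shows "max_elt S (x \<otimes> max_elt S a \<otimes> y) = max_elt S (x \<otimes> a \<otimes> y)"
  using max_elt_eq[OF sigma_rel_context[OF max_elt_sigma]] assms by simp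

lemma mu_tilde_iff:
  "(a, b) \<in> mu_tilde S \<longleftrightarrow> (a, b) \<in> mu_rel S \<and>
     (\<forall>x \<in> carrier S. \<forall>y \<in> carrier S.
        (max_elt S (x \<otimes> a \<otimes> y), max_elt S (x \<otimes> b \<otimes> y)) \<in> mu_rel S)"
  by (auto simp: mu_tilde_def mu_rel_def)

lemma congruence_mu_tilde: "congruence S (mu_tilde S)"
proof -
  have mult_mu: "\<And>a b c d. (a, b) \<in> mu_rel S \<Longrightarrow> (c, d) \<in> mu_rel S \<Longrightarrow>
    (a \<otimes> c, b \<otimes> d) \<in> mu_rel S"
    using congruence_mu_rel unfolding congruence_def by blast+
  have trans_mu: "(u, w) \<in> mu_rel S" if "(u, v) \<in> mu_rel S" "(v, w) \<in> mu_rel S" for u v w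
    using that by (auto simp: mu_rel_def)
  have "(a \<otimes> c, b \<otimes> d) \<in> mu_tilde S"
    if ab: "(a, b) \<in> mu_tilde S" and cd: "(c, d) \<in> mu_tilde S" for a b c d
  proof -
    have [simp]: "a \<in> carrier S" "b \<in> carrier S" "c \<in> carrier S" "d \<in> carrier S"
      using ab cd by (auto simp: mu_tilde_def mu_rel_def)
    have "(max_elt S (x \<otimes> (a \<otimes> c) \<otimes> y), max_elt S (x \<otimes> (b \<otimes> d) \<otimes> y)) \<in> mu_rel S"
      if [simp]: "x \<in> carrier S" "y \<in> carrier S" for x y
    proof (rule trans_mu)
      have "(max_elt S (x \<otimes> a \<otimes> (c \<otimes> y)), max_elt S (x \<otimes> b \<otimes> (c \<otimes> y))) \<in> mu_rel S"
        using ab by (simp add: mu_tilde_iff)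
      then show "(max_elt S (x \<otimes> (a \<otimes> c) \<otimes> y), max_elt S ((x \<otimes> b) \<otimes> c \<otimes> y)) \<in> mu_rel S"
        by (simp add: m_assoc)
      have "(max_elt S ((x \<otimes> b) \<otimes> c \<otimes> y), max_elt S ((x \<otimes> b) \<otimes> d \<otimes> y)) \<in> mu_rel S"
        using cd by (simp add: mu_tilde_iff)
      then show "(max_elt S ((x \<otimes> b) \<otimes> c \<otimes> y), max_elt S (x \<otimes> (b \<otimes> d) \<otimes> y)) \<in> mu_rel S"
        by (simp add: m_assoc)
    qed
    moreover have "(a \<otimes> c, b \<otimes> d) \<in> mu_rel S"
      using mult_mu mu_tilde_subset ab cd by blast
    ultimately show ?thesis by (simp add: mu_tilde_iff)
  qed
  moreover have "equiv (carrier S) (mu_tilde S)"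
    by (rule equivI) (auto simp: mu_tilde_def mu_rel_def refl_on_def sym_def trans_def)
  ultimately show ?thesis unfolding congruence_def by blast
qed

lemma F_congruence_mu_tilde: "F_congruence S (mu_tilde S)"
proof -
  have "(max_elt S a, max_elt S b) \<in> mu_tilde S" if ab: "(a, b) \<in> mu_tilde S" for a b
  proof -
    have c: "a \<in> carrier S" "b \<in> carrier S"
      using ab by (auto simp: mu_tilde_def mu_rel_def)
    have "(max_elt S (\<one> \<otimes> a \<otimes> \<one>), max_elt S (\<one> \<otimes> b \<otimes> \<one>)) \<in> mu_rel S"
      using ab unfolding mu_tilde_iff by blast
    then show ?thesis
      using ab c by (simp add: mu_tilde_iff max_elt_context)
  qed
  then show ?thesis
    using congruence_mu_tilde unfolding F_congruence_def by blast
qed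

lemma mu_tilde_greatest:
  assumes F: "F_congruence S \<rho>" and sep: "idempotent_separating S \<rho>"
  shows "\<rho> \<subseteq> mu_tilde S"
proof (rule subrelI)
  fix a b assume ab: "(a, b) \<in> \<rho>"
  have cong: "congruence S \<rho>"
    and max: "\<And>a b. (a, b) \<in> \<rho> \<Longrightarrow> (max_elt S a, max_elt S b) \<in> \<rho>"
    using F unfolding F_congruence_def by blast+
  have mult: "\<And>a b c d. (a, b) \<in> \<rho> \<Longrightarrow> (c, d) \<in> \<rho> \<Longrightarrow> (a \<otimes> c, b \<otimes> d) \<in> \<rho>"
    and rfl: "\<And>z. z \<in> carrier S \<Longrightarrow> (z, z) \<in> \<rho>"
    using cong unfolding congruence_def equiv_def refl_on_def by blast+
  have sub: "\<rho> \<subseteq> mu_rel S" by (rule mu_rel_greatest[OF cong sep])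
  have "(max_elt S (x \<otimes> a \<otimes> y), max_elt S (x \<otimes> b \<otimes> y)) \<in> \<rho>"
    if "x \<in> carrier S" "y \<in> carrier S" for x y
    using that by (intro max mult rfl ab)
  with ab sub show "(a, b) \<in> mu_tilde S" unfolding mu_tilde_iff by blast
qed

end

theorem proposition6p1:
  fixes S (structure)
  assumes "F_inverse_monoid S"
  shows "F_congruence S (mu_tilde S) \<and> idempotent_separating S (mu_tilde S) \<and>
    (\<forall>\<rho>. F_congruence S \<rho> \<and> idempotent_separating S \<rho> \<longrightarrow> \<rho> \<subseteq> mu_tilde S)"
proof -
  interpret F_inverse_monoid S by fact
  show ?thesis
    using F_congruence_mu_tilde idempotent_separating_mu_tilde mu_tilde_greatest by blast
qed

end
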